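(* Let $\{a_n\}_{n=0}^\infty\subset\mathbb{C}$ be a null sequence such that $\sum_{n=0}^\infty|a_n|<\infty$, and let $\nu\in\mathbb{C}$ with $\operatorname{Re}\nu>-\tfrac12$. Let $z\in\mathbb{C}\setminus(-\infty,0]$ if $\nu\notin\mathbb{N}_0$, and $z\in\mathbb{C}$ if $\nu\in\mathbb{N}_0$. Then the Neumann series $\mathfrak{N}_\nu(z)=\sum_{n=0}^\infty a_n J_{\nu+n}(z)$ has the integral representation $$\mathfrak{N}_\nu(z)=\frac{1}{2\pi}\int_{-\pi}^{\pi}K^{(\nu)}_z(\theta)\,A\big(e^{\mathrm{i}(\theta-\pi/2)}\big)\,\mathrm{d}\theta ,$$ where $$A(e^{\mathrm{i}\theta})=\sum_{n=0}^\infty a_n e^{\mathrm{i}n\theta}$$ and the kernel is $$K^{(\nu)}_z(\theta)=\mathrm{i}^\nu\,e^{\mathrm{i}\nu[\theta-\pi\operatorname{sgn}(\theta)]}\,e^{\mathrm{i}z\cos\theta}\,P\big(\{\nu\},-\mathrm{i}z(1-\cos\theta)\big).$$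
   Context: $J_\mu(z)=\left(\frac z2\right)^\mu\sum_{k=0}^\infty\frac{(-1)^k(z/2)^{2k}}{k!\,\Gamma(\mu+k+1)}$ is the Bessel function of the first kind, with the principal branch of the power. $\mathbb{N}_0=\{0,1,2,\ldots\}$, $\operatorname{sgn}$ is the sign function, and $\mathrm{i}^\nu=e^{\mathrm{i}\pi\nu/2}$. The complex fractional part of $\nu$ is $\{\nu\}=\nu-[\operatorname{Re}\nu]$, where for real $x$, $[x]=\lfloor x\rfloor$ if $x\ge 0$ and $[x]=\lceil x\rceil$ if $x<0$. $P(a,w)=\gamma(a,w)/\Gamma(a)$ is the regularized lower incomplete gamma function, where $\gamma(a,w)=\int_0^w t^{a-1}e^{-t}\,\mathrm{d}t$ for $\operatorname{Re}a>0$. It is extended analytically to other $a$ by $P(a,w)=w^a\gamma^*(a,w)$, where $\gamma^*(a,w)=e^{-w}\sum_{n=0}^\infty\frac{w^n}{\Gamma(a+n+1)}$ is entire in both $a$ and $w$ (with $1/\Gamma=0$ at the poles of $\Gamma$). In particular $P(0,w)=1$. Branch convention: the power of $-\mathrm{i}z(1-\cos\theta)$ contained in $P$ is taken with the phase of $-\mathrm{i}z$ equal to $\operatorname{ph}z-\pi/2$, where $\operatorname{ph}z\in(-\pi,\pi)$ is principal. Equivalently, $$\mathrm{i}^\nu P(\{\nu\},-\mathrm{i}z(1-\cos\theta))=\mathrm{i}^{[\operatorname{Re}\nu]}z^{\{\nu\}}(1-\cos\theta)^{\{\nu\}}\gamma^*(\{\nu\},-\mathrm{i}z(1-\cos\theta)),$$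 with the principal branch of $z^{\{\nu\}}$. *)

theory Defs
  imports "HOL-Analysis.Analysis"
begin

text \<open>Principal branch of \<open>z\<^sup>a\<close>. It differs from \<^term>\<open>z powr a\<close> only at \<open>z = a = 0\<close>, where the
  library has \<open>0 powr 0 = 0\<close> but \<open>J\<^sub>0(0) = 1\<close> and \<open>P(0,0) = 1\<close> require \<open>0\<^sup>0 = 1\<close>.\<close>

definition cpow :: "complex \<Rightarrow> complex \<Rightarrow> complex" where
  "cpow z a = (if a = 0 then 1 else z powr a)"

lemma cpow_of_nat: "cpow z (of_nat n) = z ^ n"
  by (cases "z = 0") (auto simp: cpow_def powr_nat)

definition bessel_J :: "complex \<Rightarrow> complex \<Rightarrow> complex" where
  "bessel_J \<mu> z = cpow (z / 2) \<mu> *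
     (\<Sum>k. (-1) ^ k * (z / 2) ^ (2 * k) / (fact k * Gamma (\<mu> + of_nat k + 1)))"

definition neumann_series :: "(nat \<Rightarrow> complex) \<Rightarrow> complex \<Rightarrow> complex \<Rightarrow> complex" where
  "neumann_series a \<nu> z = (\<Sum>n. a n * bessel_J (\<nu> + of_nat n) z)"

definition int_part :: "real \<Rightarrow> int" where
  "int_part x = (if x \<ge> 0 then \<lfloor>x\<rfloor> else \<lceil>x\<rceil>)"

definition cfrac_part :: "complex \<Rightarrow> complex" where
  "cfrac_part \<nu> = \<nu> - of_int (int_part (Re \<nu>))"

text \<open>\<^term>\<open>rGamma\<close> is the entire function \<open>1/\<Gamma>\<close>.\<close>

definition gamma_star :: "complex \<Rightarrow> complex \<Rightarrow> complex" where
  "gamma_star a w = exp (- w) * (\<Sum>n. w ^ n * rGamma (a + of_nat n + 1))"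

text \<open>\<open>P(a,w) = w\<^sup>a \<gamma>\<^sup>*(a,w)\<close> is multivalued in \<open>w\<close>, so \<open>w = r e\<^bsup>i\<phi>\<^esup>\<close> is given by its modulus
  \<open>r \<ge> 0\<close> and a chosen phase \<open>\<phi>\<close>, and \<open>w\<^sup>a\<close> means \<open>r\<^sup>a e\<^bsup>ia\<phi>\<^esup>\<close>.\<close>

definition reg_gamma_P :: "complex \<Rightarrow> real \<Rightarrow> real \<Rightarrow> complex" where
  "reg_gamma_P a r \<phi> =
     cpow (of_real r) a * exp (\<i> * a * of_real \<phi>) * gamma_star a (of_real r * cis \<phi>)"

text \<open>The argument of \<open>P\<close> is \<open>-iz(1 - cos \<theta>)\<close>, with the phase of \<open>-iz\<close> taken to be
  \<open>ph z - \<pi>/2\<close>.\<close>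

definition neumann_kernel :: "complex \<Rightarrow> complex \<Rightarrow> real \<Rightarrow> complex" where
  "neumann_kernel \<nu> z \<theta> =
     exp (\<i> * of_real pi * \<nu> / 2) * exp (\<i> * \<nu> * of_real (\<theta> - pi * sgn \<theta>)) *
     exp (\<i> * z * of_real (cos \<theta>)) *
     reg_gamma_P (cfrac_part \<nu>) (cmod z * (1 - cos \<theta>)) (Arg z - pi / 2)"

lemma polar_kernel_argument:
  "of_real (cmod z * (1 - cos \<theta>)) * cis (Arg z - pi / 2) = - \<i> * z * of_real (1 - cos \<theta>)"
proof -
  have "of_real (cmod z) * cis (Arg z) = z"
    by (metis rcis_cmod_Arg rcis_def)
  moreover have "cis (Arg z - pi / 2) = cis (Arg z) * - \<i>"
    by (simp add: complex_eq_iff cos_diff sin_diff)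
  ultimately show ?thesis
    by (metis (no_types, opaque_lifting) mult.assoc mult.commute of_real_mult)
qed

lemma reg_gamma_P_principal_branch:
  "exp (\<i> * of_real pi * \<nu> / 2) *
     reg_gamma_P (cfrac_part \<nu>) (cmod z * (1 - cos \<theta>)) (Arg z - pi / 2) =
   \<i> powi int_part (Re \<nu>) * cpow z (cfrac_part \<nu>) * cpow (of_real (1 - cos \<theta>)) (cfrac_part \<nu>) *
     gamma_star (cfrac_part \<nu>) (- \<i> * z * of_real (1 - cos \<theta>))"
proof -
  define a m c where "a = cfrac_part \<nu>" and "m = int_part (Re \<nu>)" and "c = 1 - cos \<theta>"
  have c: "c \<ge> 0" by (simp add: c_def)
  have nu: "\<nu> = a + of_int m" by (simp add: a_def m_def cfrac_part_def)
  have im: "\<i> powi m = exp (\<i> * of_real pi * of_int m / 2)"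
  proof -
    have "\<i> = exp (\<i> * of_real pi / 2)" by (simp add: exp_eq_polar cis_conv_exp[symmetric] flip: cis_pi_half)
    then have "\<i> powi m = exp (\<i> * of_real pi / 2) powi m" by simp
    also have "\<dots> = exp (of_int m * (\<i> * of_real pi / 2))" by (simp only: exp_power_int)
    finally show ?thesis by (simp add: mult_ac)
  qed
  have e: "exp (\<i> * of_real pi * \<nu> / 2) = \<i> powi m * exp (\<i> * of_real pi * a / 2)"
    unfolding im nu by (simp add: ring_distribs add_divide_distrib exp_add)
  have key: "exp (\<i> * of_real pi * a / 2) *
      (cpow (of_real (cmod z * c)) a * exp (\<i> * a * of_real (Arg z - pi / 2))) =
      cpow z a * cpow (of_real c) a"
  proof (cases "a = 0 \<or> z = 0 \<or> c = 0")
    case True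
    then show ?thesis by (auto simp: cpow_def)
  next
    case False
    with c have "c > 0" by auto
    with False show ?thesis
      by (simp add: cpow_def powr_def Ln_Arg Ln_of_real ln_mult exp_add [symmetric] algebra_simps
          add_divide_distrib diff_divide_distrib norm_mult)
  qed
  show ?thesis
    unfolding reg_gamma_P_def a_def [symmetric] m_def [symmetric] c_def [symmetric] e
      polar_kernel_argument [of z \<theta>, folded c_def]
    by (subst (2) mult.assoc) (simp only: key [symmetric] mult_ac)
qed

text \<open>The values \<open>A(w)\<close> are used on the unit circle, \<open>w = e\<^bsup>i\<theta>\<^esup>\<close>.\<close>

definition gen_series :: "(nat \<Rightarrow> complex) \<Rightarrow> complex \<Rightarrow> complex" where
  "gen_series a w = (\<Sum>n. a n * w ^ n)"

end

theory Submission imports Defs begin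

text \<open>Put \<open>u = - e\<^bsup>i\<theta>\<^esup>\<close>, so that \<open>1 - cos \<theta> = (1 + u)\<^sup>2 / (2 u)\<close>. Expanding \<open>\<gamma>\<^sup>*\<close> in its power
  series writes the kernel times \<open>e\<^bsup>i n (\<theta> - \<pi>/2)\<^esup>\<close> as a series of terms \<open>(1 + u)\<^sup>\<alpha>\<close> times an integer
  power of \<open>u\<close>, where \<open>\<alpha> = 2{\<nu>} + 2k\<close>. The Fourier coefficients of \<open>(1 + u)\<^sup>\<alpha>\<close> are binomial
  coefficients, and the resulting series is \<open>(z/2)\<^sup>\<mu> e\<^bsup>iz\<^esup> \<^sub>1F\<^sub>1(\<mu> + 1/2; 2\<mu> + 1; -2iz) / \<Gamma>(\<mu> + 1)\<close> with
  \<open>\<mu> = \<nu> + n\<close>, which is \<open>J\<^sub>\<mu>(z)\<close> by Kummer's second transformation. Since the kernel is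
  integrable and \<open>\<Sum>\<bar>a\<^sub>n\<bar>\<close> converges, the identity for each \<open>n\<close> can be summed under the integral.\<close>

subsection \<open>Series\<close>

text \<open>The bound splits into a summable factor and an integrable factor, so the norms are
  summable pointwise and so are their integrals; this is what termwise integration needs. The
  binomial series, the expansion of the kernel and the final sum are all integrated in this
  way.\<close>

lemma dominated_series:
  fixes f :: "nat \<Rightarrow> 'a \<Rightarrow> 'b :: {banach, second_countable_topology}" and w :: "'a \<Rightarrow> real"
  assumes meas: "\<And>i. f i \<in> borel_measurable M" and w: "integrable M w"
    and bound: "\<And>i x. x \<in> space M \<Longrightarrow> norm (f i x) \<le> B i * w x" and B: "summable B"
  shows dominated_series_integrable: "integrable M (\<lambda>x. \<Sum>i. f i x)"
    and dominated_series_sums: "(\<lambda>i. integral\<^sup>L M (f i)) sums (\<integral>x. (\<Sum>i. f i x) \<partial>M)"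
proof -
  have int: "integrable M (f i)" for i
  proof (rule Bochner_Integration.integrable_bound)
    show "integrable M (\<lambda>x. B i * w x)" using w by simp
    show "AE x in M. norm (f i x) \<le> norm (B i * w x)"
      using bound by (intro AE_I2) (smt (verit) real_norm_def)
  qed (rule meas)
  have s1: "AE x in M. summable (\<lambda>i. norm (f i x))"
    using bound B by (intro AE_I2 summable_comparison_test'[OF summable_mult2[OF B]]) auto
  have "(\<integral>x. norm (f i x) \<partial>M) \<le> B i * integral\<^sup>L M w" for i
  proof -
    have "(\<integral>x. norm (f i x) \<partial>M) \<le> (\<integral>x. B i * w x \<partial>M)"
      using int w bound by (intro integral_mono) auto
    then show ?thesis by simp
  qed
  then have s2: "summable (\<lambda>i. \<integral>x. norm (f i x) \<partial>M)"
    by (intro summable_comparison_test'[OF summable_mult2[OF B, of "integral\<^sup>L M w"]]) auto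
  show "integrable M (\<lambda>x. \<Sum>i. f i x)" by (rule integrable_suminf[OF int s1 s2])
  show "(\<lambda>i. integral\<^sup>L M (f i)) sums (\<integral>x. (\<Sum>i. f i x) \<partial>M)" by (rule sums_integral[OF int s1 s2])
qed

text \<open>Ratio test: \<open>q n * x\<close> tends to 0 for every \<open>x\<close>, so the power
  series converges absolutely everywhere. A multiplier \<open>q\<close> in place of a quotient lets
  coefficients vanish.\<close>

lemma summable_norm_power_series_ratio_null:
  fixes c q :: "nat \<Rightarrow> 'a :: {real_normed_field, banach}" and x :: 'a
  assumes rec: "\<And>n. c (Suc n) = q n * c n" and q: "q \<longlonglongrightarrow> 0"
  shows "summable (\<lambda>n. norm (c n * x ^ n))"
proof -
  have "(\<lambda>n. norm (q n * x)) \<longlonglongrightarrow> norm (0 * x)"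
    using q by (intro tendsto_intros)
  then have "eventually (\<lambda>n. norm (q n * x) < 1/2) sequentially"
    by (intro order_tendstoD(2)[where y = "norm (0 * x)"]) auto
  then obtain N where N: "\<And>n. n \<ge> N \<Longrightarrow> norm (q n * x) < 1/2"
    by (auto simp: eventually_sequentially)
  show ?thesis
  proof (rule summable_ratio_test[of "1/2" N])
    fix n assume "n \<ge> N"
    have "norm (c (Suc n) * x ^ Suc n) = norm (q n * x) * norm (c n * x ^ n)"
      by (simp add: rec norm_mult norm_power mult_ac)
    also have "\<dots> \<le> 1/2 * norm (c n * x ^ n)"
      using N[OF \<open>n \<ge> N\<close>] by (intro mult_right_mono) auto
    finally show "norm (norm (c (Suc n) * x ^ Suc n)) \<le> 1/2 * norm (norm (c n * x ^ n))" by simp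
  qed auto
qed

lemma inverse_plus_of_nat_tendsto_0:
  fixes c :: complex
  shows "(\<lambda>n. inverse (c + of_nat n)) \<longlonglongrightarrow> 0"
  by (intro tendsto_inverse_0[THEN filterlim_compose]
      tendsto_add_filterlim_at_infinity[OF tendsto_const] tendsto_of_nat)

lemma summable_norm_rGamma_series:
  fixes a x :: complex
  shows "summable (\<lambda>n. norm (rGamma (a + of_nat n + 1) * x ^ n))"
proof -
  obtain N where N: "\<And>n. n \<ge> N \<Longrightarrow> a + 1 + of_nat n \<noteq> 0"
  proof -
    obtain N where "real N > norm (a + 1)" using reals_Archimedean2 by blast
    then have "a + 1 + of_nat n \<noteq> 0" if "n \<ge> N" for n
      using that by (metis add_eq_0_iff2 norm_minus_cancel norm_of_nat not_less of_nat_le_iff)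
    then show ?thesis using that by blast
  qed
  \<comment> \<open>The functional equation of \<open>rGamma\<close> can be divided by
    \<open>a + 1 + n\<close> only where this is nonzero, hence the shift by
    \<open>N\<close>.\<close>
  have "summable (\<lambda>n. norm (rGamma (a + of_nat (n + N) + 1) * x ^ n))"
  proof (rule summable_norm_power_series_ratio_null)
    show "rGamma (a + of_nat (Suc n + N) + 1) =
        inverse (a + 1 + of_nat (n + N)) * rGamma (a + of_nat (n + N) + 1)" for n
      using rGamma_plus1[of "a + of_nat (n + N) + 1"] N[of "n + N"]
      by (simp add: field_simps)
    show "(\<lambda>n. inverse (a + 1 + of_nat (n + N))) \<longlonglongrightarrow> 0"
      using LIMSEQ_ignore_initial_segment[OF inverse_plus_of_nat_tendsto_0] .
  qed
  then have "summable (\<lambda>n. norm (rGamma (a + of_nat (n + N) + 1) * x ^ (n + N)))"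
    by (drule_tac summable_mult2[where c = "norm (x ^ N)"]) (simp add: power_add norm_mult mult_ac)
  then show ?thesis using summable_iff_shift by blast
qed

subsection \<open>Fourier coefficients of complex powers\<close>

text \<open>The point \<open>0\<close>, where \<open>1 - e\<^bsup>i\<theta>\<^esup>\<close> vanishes, is removed so that the integrands are
  continuous on the whole space.\<close>

definition circ :: "real measure" where
  "circ = restrict_space lborel ({-pi..pi} - {0})"

lemma space_circ: "space circ = {-pi..pi} - {0}"
  by (simp add: circ_def space_restrict_space)

text \<open>The removed point is a null set, so integrals over \<open>circ\<close> agree with those
  over the full interval.\<close>

lemma circ_integrable_iff:
  fixes f :: "real \<Rightarrow> 'a :: {banach, second_countable_topology}"
  shows "integrable circ f \<longleftrightarrow> set_integrable lborel {-pi..pi} f"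
  unfolding circ_def set_integrable_def
  by (subst integrable_restrict_space, simp, rule integrable_discrete_difference[where X = "{0}"])
    (auto simp: indicator_def)

lemma circ_integral_eq:
  fixes f :: "real \<Rightarrow> 'a :: {banach, second_countable_topology}"
  shows "integral\<^sup>L circ f = (LINT x:{-pi..pi}|lborel. f x)"
  unfolding circ_def set_lebesgue_integral_def
  by (subst integral_restrict_space, simp, rule integral_discrete_difference[where X = "{0}"])
    (auto simp: indicator_def)

lemma circ_measurable_continuous:
  assumes "continuous_on ({-pi..pi} - {0}) f"
  shows "f \<in> borel_measurable circ"
proof -
  have "sets circ = sets (restrict_space borel ({-pi..pi} - {0}))"
    unfolding circ_def by (intro sets_restrict_space_cong) simp
  then show ?thesis
    using borel_measurable_continuous_on_restrict[OF assms] measurable_cong_sets by blast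
qed

lemma circ_integrable_const: "integrable circ (\<lambda>_. c :: real)"
  unfolding circ_integrable_iff set_integrable_def by simp

text \<open>The function \<open>sin x - x * cos x\<close> vanishes at 0 and has derivative
  \<open>x * sin x\<close>, so it is nonnegative at \<open>y/2\<close>. Doubling the angle then
  gives \<open>sin y \<ge> y * cos (y/2) ^ 2\<close>, and the squared cosine is at least 1/2 because
  \<open>cos y \<ge> 0\<close>.\<close>

lemma half_le_sin:
  fixes y :: real
  assumes "0 \<le> y" "y \<le> pi / 2"
  shows "y / 2 \<le> sin y"
proof -
  define f :: "real \<Rightarrow> real" where "f = (\<lambda>x. sin x - x * cos x)"
  have "f 0 \<le> f (y/2)"
  proof (rule DERIV_nonneg_imp_nondecreasing[where f = f])
    fix x :: real assume x: "0 \<le> x" "x \<le> y/2"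
    have "(f has_field_derivative x * sin x) (at x)"
      unfolding f_def by (auto intro!: derivative_eq_intros)
    moreover have "x * sin x \<ge> 0" using x assms by (intro mult_nonneg_nonneg sin_ge_zero) auto
    ultimately show "\<exists>d. (f has_field_derivative d) (at x) \<and> d \<ge> 0" by blast
  qed (use assms in auto)
  then have s: "y/2 * cos (y/2) \<le> sin (y/2)" by (simp add: f_def)
  have c0: "cos (y/2) \<ge> 0" using assms by (intro cos_ge_zero) auto
  have "cos y = 2 * cos (y/2) ^ 2 - 1" using cos_double_cos[of "y/2"] by simp
  moreover have "cos y \<ge> 0" using assms by (intro cos_ge_zero) auto
  ultimately have "1/2 \<le> cos (y/2) * cos (y/2)" by (simp add: power2_eq_square)
  then have "y * (1/2) \<le> y * (cos (y/2) * cos (y/2))" using assms by (intro mult_left_mono) auto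
  also have "\<dots> = 2 * (y/2 * cos (y/2)) * cos (y/2)" by simp
  also have "\<dots> \<le> 2 * sin (y/2) * cos (y/2)" using s c0 by (intro mult_right_mono) auto
  also have "\<dots> = sin y" using sin_double[of "y/2"] by simp
  finally show ?thesis by simp
qed

lemma norm_one_minus_cis: "norm (1 - cis \<theta>) = 2 * \<bar>sin (\<theta> / 2)\<bar>"
proof -
  have "(norm (1 - cis \<theta>))\<^sup>2 = (1 - cos \<theta>)\<^sup>2 + (sin \<theta>)\<^sup>2" by (simp add: cmod_power2)
  also have "\<dots> = 2 - 2 * cos \<theta>" using sin_cos_squared_add[of \<theta>] by (simp add: power2_eq_square algebra_simps)
  also have "\<dots> = (2 * \<bar>sin (\<theta> / 2)\<bar>)\<^sup>2" using cos_double_sin[of "\<theta>/2"] by (simp add: power_mult_distrib)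
  finally show ?thesis by (rule power2_eq_imp_eq) auto
qed

text \<open>The bound must be uniform in \<open>r\<close> to serve in the limit \<open>r\<close> to
  1. The distance from \<open>r * cis \<theta>\<close> to \<open>cis \<theta>\<close> is
  \<open>1 - r\<close>, itself at most the norm being estimated, so replacing \<open>r\<close> by 1
  costs only a factor 2.\<close>

lemma norm_one_minus_cis_ge:
  assumes "r \<in> {0..1}" "\<bar>\<theta>\<bar> \<le> pi"
  shows "\<bar>\<theta>\<bar> / 4 \<le> norm (1 - of_real r * cis \<theta>)"
proof -
  have "\<bar>sin (\<theta>/2)\<bar> = sin (\<bar>\<theta>\<bar>/2)"
  proof (cases "\<theta> \<ge> 0")
    case True
    then show ?thesis using assms sin_ge_zero[of "\<theta>/2"] by simp
  next
    case False
    then show ?thesis using assms sin_ge_zero[of "-\<theta>/2"] by simp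
  qed
  then have 1: "\<bar>\<theta>\<bar>/2 \<le> norm (1 - cis \<theta>)"
    using half_le_sin[of "\<bar>\<theta>\<bar>/2"] assms by (simp add: norm_one_minus_cis)
  have "norm (1 - cis \<theta>) = norm ((1 - of_real r * cis \<theta>) - of_real (1 - r) * cis \<theta>)"
    by (simp add: algebra_simps)
  also have "\<dots> \<le> norm (1 - of_real r * cis \<theta>) + norm (of_real (1 - r) * cis \<theta>)"
    by (rule norm_triangle_ineq4)
  also have "norm (of_real (1 - r) * cis \<theta>) = 1 - r" using assms by (simp add: norm_mult del: of_real_diff)
  also have "1 - r \<le> norm (1 - of_real r * cis \<theta>)"
    using norm_triangle_ineq2[of 1 "of_real r * cis \<theta>"] assms by (simp add: norm_mult)
  finally show ?thesis using 1 by simp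
qed

text \<open>The two halves of the interval are mirror images. The antiderivative yields gauge
  integrability; nonnegativity makes it absolute, and measurability takes it from
  \<open>lebesgue\<close> to \<open>lborel\<close>.\<close>

lemma circ_integrable_abs_powr:
  assumes "s > -1"
  shows "integrable circ (\<lambda>x. \<bar>x\<bar> powr s)"
proof -
  have 1: "(\<lambda>x. \<bar>x\<bar> powr s) integrable_on {0..pi}"
  proof (rule integrable_eq)
    show "(\<lambda>x. x powr s) integrable_on {0..pi}"
      using has_integral_powr_from_0[OF assms, of pi] by (auto simp: integrable_on_def)
  qed auto
  then have 2: "(\<lambda>x. \<bar>x\<bar> powr s) integrable_on {-pi..0}"
    using Henstock_Kurzweil_Integration.integrable_reflect_real[of "\<lambda>x. \<bar>x\<bar> powr s" pi 0] by simp
  have "(\<lambda>x. \<bar>x\<bar> powr s) integrable_on {-pi..pi}"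
    by (rule Henstock_Kurzweil_Integration.integrable_combine[OF _ _ 2 1]) auto
  then have "(\<lambda>x. \<bar>x\<bar> powr s) absolutely_integrable_on {-pi..pi}"
    by (intro nonnegative_absolutely_integrable_1) auto
  then have "integrable lebesgue (\<lambda>x. indicator {-pi..pi} x *\<^sub>R (\<bar>x\<bar> powr s))"
    by (simp add: set_integrable_def)
  then show ?thesis
    unfolding circ_integrable_iff set_integrable_def
    by (subst (asm) integrable_completion) auto
qed

text \<open>A complex power has norm
  \<open>norm v powr Re \<alpha> * exp (- Im \<alpha> * Arg v)\<close>. The second factor is bounded
  since the argument is; the first is controlled by \<open>norm v \<le> 2\<close> or by the lower
  bound \<open>\<bar>\<theta>\<bar> / 4\<close>, according to the sign of
  \<open>Re \<alpha>\<close>.\<close>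

lemma one_minus_cis_powr_dominated:
  assumes "Re \<alpha> > -1"
  obtains w where "integrable circ w"
    "\<And>r \<theta>. r \<in> {0..1} \<Longrightarrow> \<theta> \<in> {-pi..pi} - {0} \<Longrightarrow> norm ((1 - of_real r * cis \<theta>) powr \<alpha>) \<le> w \<theta>"
proof
  \<comment> \<open>The two summands are the majorants for \<open>Re \<alpha> \<ge> 0\<close> and
    \<open>Re \<alpha> < 0\<close>; their sum serves for both.\<close>
  define w where "w \<theta> = exp (\<bar>Im \<alpha>\<bar> * pi) * (2 powr Re \<alpha> + (\<bar>\<theta>\<bar> powr Re \<alpha>) * (1/4) powr Re \<alpha>)" for \<theta>
  show "integrable circ w"
    unfolding w_def using circ_integrable_abs_powr[OF assms] circ_integrable_const by simp
  fix r \<theta> :: real assume r: "r \<in> {0..1}" and t: "\<theta> \<in> {-pi..pi} - {0}"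
  define v where "v = 1 - of_real r * cis \<theta>"
  have lo: "\<bar>\<theta>\<bar> / 4 \<le> norm v" unfolding v_def using r t by (intro norm_one_minus_cis_ge) auto
  have hi: "norm v \<le> 2"
    unfolding v_def using norm_triangle_ineq4[of 1 "of_real r * cis \<theta>"] r by (simp add: norm_mult)
  have "norm v powr Re \<alpha> \<le> 2 powr Re \<alpha> + (\<bar>\<theta>\<bar> powr Re \<alpha>) * (1/4) powr Re \<alpha>"
  proof (cases "Re \<alpha> \<ge> 0")
    case True
    then have "norm v powr Re \<alpha> \<le> 2 powr Re \<alpha>" using hi by (intro powr_mono2) auto
    then show ?thesis by (smt (verit) mult_nonneg_nonneg powr_ge_zero)
  next
    case False
    have "norm v powr Re \<alpha> \<le> (\<bar>\<theta>\<bar> / 4) powr Re \<alpha>" using lo False t by (intro powr_mono2') auto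
    also have "\<dots> = (\<bar>\<theta>\<bar> powr Re \<alpha>) * (1/4) powr Re \<alpha>"
      using powr_mult[of "\<bar>\<theta>\<bar>" "1/4" "Re \<alpha>"] by simp
    finally show ?thesis by (smt (verit) powr_ge_zero)
  qed
  moreover have "exp (- Im \<alpha> * Arg v) \<le> exp (\<bar>Im \<alpha>\<bar> * pi)"
  proof -
    have "\<bar>Arg v\<bar> \<le> pi" using Arg_bounded[of v] by auto
    then have "\<bar>Im \<alpha>\<bar> * \<bar>Arg v\<bar> \<le> \<bar>Im \<alpha>\<bar> * pi" by (intro mult_left_mono) auto
    then have "- Im \<alpha> * Arg v \<le> \<bar>Im \<alpha>\<bar> * pi" by (metis abs_ge_self abs_minus_cancel abs_mult order_trans)
    then show ?thesis by simp
  qed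
  ultimately have "norm v powr Re \<alpha> * exp (- Im \<alpha> * Arg v) \<le> w \<theta>"
    unfolding w_def by (subst (2) mult.commute) (intro mult_mono, auto)
  then show "norm ((1 - of_real r * cis \<theta>) powr \<alpha>) \<le> w \<theta>"
    by (simp add: norm_powr_complex v_def)
qed

lemma circ_integral_cis:
  "(\<integral>\<theta>. cis (of_int k * \<theta>) \<partial>circ) = (if k = 0 then 2 * of_real pi else 0)"
proof (cases "k = 0")
  case True
  have "(\<integral>\<theta>. 1 \<partial>circ) = (2 * of_real pi :: complex)"
    unfolding circ_integral_eq set_lebesgue_integral_def by (simp add: scaleR_conv_of_real)
  with True show ?thesis by simp
next
  case False
  have "(\<integral>\<theta>. cis (of_int k * \<theta>) \<partial>circ) =
     cis (of_int k * pi) / (\<i> * of_int k) - cis (of_int k * (-pi)) / (\<i> * of_int k)"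
    unfolding circ_integral_eq set_lebesgue_integral_def
  proof (rule integral_FTC_atLeastAtMost)
    fix x :: real
    have "((\<lambda>x. exp (\<i> * of_int k * x)) has_field_derivative (\<i> * of_int k * exp (\<i> * of_int k * x))) (at (of_real x))" for x
      by (auto intro!: derivative_eq_intros)
    from has_vector_derivative_real_field[OF this]
    have "((\<lambda>x. exp (\<i> * of_int k * of_real x)) has_vector_derivative (\<i> * of_int k * exp (\<i> * of_int k * of_real x))) (at x within {-pi..pi})"
      by simp
    then have "((\<lambda>x. cis (of_int k * x)) has_vector_derivative (\<i> * of_int k * cis (of_int k * x))) (at x within {-pi..pi})"
      by (simp add: cis_conv_exp mult.assoc)
    from has_vector_derivative_divide[OF this, of "\<i> * of_int k"] False
    show "((\<lambda>x. cis (of_int k * x) / (\<i> * of_int k)) has_vector_derivative cis (of_int k * x)) (at x within {-pi..pi})"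
      by simp
  qed (auto intro!: continuous_intros)
  also have "cis (of_int k * pi) = cis (of_int k * (-pi))"
  proof -
    have "sin (of_int k * pi) = 0" by (metis sin_zero_iff_int2)
    then show ?thesis by (simp add: complex_eq_iff)
  qed
  finally show ?thesis using False by simp
qed

text \<open>Orthogonality of the powers of \<open>u = - cis \<theta>\<close>. Negative powers are
  written as powers of the conjugate, which keeps all exponents natural numbers.\<close>

lemma circ_integral_unit_powers:
  "(\<integral>\<theta>. (- cis \<theta>) ^ m * cnj (- cis \<theta>) ^ n \<partial>circ) = (if m = n then 2 * of_real pi else 0)"
proof -
  have "(- cis \<theta>) ^ m * cnj (- cis \<theta>) ^ n = (-1) ^ (m + n) * cis (of_int (int m - int n) * \<theta>)" for \<theta>
  proof -
    have "(- cis \<theta>) ^ m = (-1) ^ m * cis (m * \<theta>)"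
      by (subst power_minus) (simp add: Complex.DeMoivre)
    moreover have "cnj (- cis \<theta>) ^ n = (-1) ^ n * cis (- (n * \<theta>))"
      by (simp add: cis_cnj, subst power_minus) (simp add: Complex.DeMoivre)
    moreover have "cis (m * \<theta>) * cis (- (n * \<theta>)) = cis (of_int (int m - int n) * \<theta>)"
      by (simp add: cis_mult algebra_simps)
    ultimately show ?thesis by (simp only: power_add mult_ac)
  qed
  then have "(\<integral>\<theta>. (- cis \<theta>) ^ m * cnj (- cis \<theta>) ^ n \<partial>circ) =
      (-1) ^ (m + n) * (\<integral>\<theta>. cis (of_int (int m - int n) * \<theta>) \<partial>circ)"
    by (simp only: integral_mult_right_zero)
  also have "\<dots> = (if m = n then 2 * of_real pi else 0)"
  proof (cases "m = n")
    case True
    then have "(-1 :: complex) ^ (m + n) = 1" by simp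
    with True show ?thesis by (simp only: circ_integral_cis) simp
  next
    case False
    then show ?thesis by (simp only: circ_integral_cis) simp
  qed
  finally show ?thesis .
qed

text \<open>For \<open>r < 1\<close> the binomial series of \<open>(1 + r * u) powr \<alpha>\<close>
  with \<open>u = - cis \<theta>\<close> has an absolutely summable bound independent of \<theta>.
  Orthogonality retains only the index \<open>j\<close> with \<open>j + q = p\<close>, which exists
  just when \<open>q \<le> p\<close>.\<close>

lemma circ_integral_binomial_inner:
  assumes "0 \<le> r" "r < 1"
  shows "(\<integral>\<theta>. (1 - of_real r * cis \<theta>) powr \<alpha> * ((- cis \<theta>) ^ q * cnj (- cis \<theta>) ^ p) \<partial>circ) =
    (if q \<le> p then 2 * of_real pi * (\<alpha> gchoose (p - q)) * of_real r ^ (p - q) else 0)"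
proof -
  define f where "f j \<theta> = ((\<alpha> gchoose j) * of_real r ^ j) * ((- cis \<theta>) ^ (j + q) * cnj (- cis \<theta>) ^ p)"
    for j :: nat and \<theta> :: real
  have f_sum: "(\<Sum>j. f j \<theta>) = (1 - of_real r * cis \<theta>) powr \<alpha> * ((- cis \<theta>) ^ q * cnj (- cis \<theta>) ^ p)" for \<theta>
  proof -
    have "(\<lambda>j. (\<alpha> gchoose j) * (of_real r * - cis \<theta>) ^ j) sums (1 + of_real r * - cis \<theta>) powr \<alpha>"
      using assms by (intro gen_binomial_complex) (simp add: norm_mult)
    then have "(\<lambda>j. (\<alpha> gchoose j) * (of_real r * - cis \<theta>) ^ j * ((- cis \<theta>) ^ q * cnj (- cis \<theta>) ^ p)) sums
      ((1 + of_real r * - cis \<theta>) powr \<alpha> * ((- cis \<theta>) ^ q * cnj (- cis \<theta>) ^ p))"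
      by (rule sums_mult2)
    moreover have "f j \<theta> = (\<alpha> gchoose j) * (of_real r * - cis \<theta>) ^ j * ((- cis \<theta>) ^ q * cnj (- cis \<theta>) ^ p)" for j
      unfolding f_def power_add power_mult_distrib by (simp only: mult_ac)
    ultimately show ?thesis by (simp add: sums_iff)
  qed
  have sum: "summable (\<lambda>j. norm ((\<alpha> gchoose j) * of_real r ^ j))"
    using assms by (intro abs_summable_in_conv_radius) (simp add: conv_radius_gchoose)
  have "(\<lambda>j. integral\<^sup>L circ (f j)) sums (\<integral>\<theta>. (\<Sum>j. f j \<theta>) \<partial>circ)"
  proof (rule dominated_series_sums[OF _ circ_integrable_const[of 1] _ sum])
    show "f j \<in> borel_measurable circ" for j
      unfolding f_def by (intro circ_measurable_continuous continuous_intros)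
    show "norm (f j \<theta>) \<le> norm ((\<alpha> gchoose j) * of_real r ^ j) * 1" for j \<theta>
      unfolding f_def by (simp add: norm_mult norm_power)
  qed
  moreover have "integral\<^sup>L circ (f j) = (if q \<le> p \<and> j = p - q then
      2 * of_real pi * (\<alpha> gchoose (p - q)) * of_real r ^ (p - q) else 0)" for j
    unfolding f_def integral_mult_right_zero circ_integral_unit_powers by auto
  moreover have "(\<lambda>j. if q \<le> p \<and> j = p - q then c else 0) sums (if q \<le> p then c else 0)" for c :: complex
    using sums_single[of "p - q" "\<lambda>_. c"] by (auto simp: sums_zero)
  ultimately show ?thesis unfolding f_sum by (simp add: sums_unique2)
qed

text \<open>The base of the power stays in the open right half plane, away from the branch cut, so
  the principal power is continuous in both \<open>r\<close> and \<theta>. At \<open>r = 1\<close>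
  this relies on the exclusion of \<theta> = 0.\<close>

lemma Re_one_minus_cis_pos:
  assumes "r \<in> {0..1}" "\<theta> \<in> {-pi..pi} - {0}"
  shows "Re (1 - of_real r * cis \<theta>) > 0"
proof -
  have "\<bar>\<theta>\<bar> > 0" "\<bar>\<theta>\<bar> \<le> pi" using assms by auto
  then have "cos \<bar>\<theta>\<bar> < cos 0" by (intro cos_monotone_0_pi) auto
  then have "cos \<theta> < 1" by simp
  then have "r * cos \<theta> < 1"
    using assms mult_left_le_one_le[of "cos \<theta>" r] mult_nonneg_nonpos[of r "cos \<theta>"]
    by (cases "cos \<theta> \<ge> 0") auto
  then show ?thesis by simp
qed

lemma circ_measurable_one_minus_cis_powr:
  assumes "r \<in> {0..1}"
  shows "(\<lambda>\<theta>. (1 - of_real r * cis \<theta>) powr \<alpha> * ((- cis \<theta>) ^ q * cnj (- cis \<theta>) ^ p)) \<in> borel_measurable circ"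
proof -
  have "continuous_on ({-pi..pi} - {0}) (\<lambda>\<theta>. (1 - of_real r * cis \<theta>) powr \<alpha>)"
    unfolding continuous_on_def
  proof
    fix \<theta> :: real assume t: "\<theta> \<in> {-pi..pi} - {0}"
    show "((\<lambda>\<theta>. (1 - of_real r * cis \<theta>) powr \<alpha>) \<longlongrightarrow> (1 - of_real r * cis \<theta>) powr \<alpha>) (at \<theta> within {-pi..pi} - {0})"
      using Re_one_minus_cis_pos[OF assms t]
      by (intro tendsto_powr_complex tendsto_intros) (auto simp: complex_nonpos_Reals_iff)
  qed
  then show ?thesis
    by (intro circ_measurable_continuous continuous_on_mult) (auto intro!: continuous_intros)
qed

text \<open>The binomial series gives the integral over circles of radius \<open>r < 1\<close>; dominated convergence
  lets \<open>r\<close> tend to \<open>1\<close>.\<close>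

lemma circ_integral_binomial:
  assumes "Re \<alpha> > -1"
  shows "(\<integral>\<theta>. (1 - cis \<theta>) powr \<alpha> * ((- cis \<theta>) ^ q * cnj (- cis \<theta>) ^ p) \<partial>circ) =
    (if q \<le> p then 2 * of_real pi * (\<alpha> gchoose (p - q)) else 0)"
proof -
  obtain w where w: "integrable circ w"
    "\<And>r \<theta>. r \<in> {0..1} \<Longrightarrow> \<theta> \<in> {-pi..pi} - {0} \<Longrightarrow> norm ((1 - of_real r * cis \<theta>) powr \<alpha>) \<le> w \<theta>"
    using one_minus_cis_powr_dominated[OF assms] by blast
  define r where "r i = real i / real (Suc i)" for i
  have r: "r i \<in> {0..<1}" for i by (auto simp: r_def field_simps)
  have r_lim: "r \<longlonglongrightarrow> 1" unfolding r_def by (rule LIMSEQ_n_over_Suc_n)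
  have "(\<lambda>i. \<integral>\<theta>. (1 - of_real (r i) * cis \<theta>) powr \<alpha> * ((- cis \<theta>) ^ q * cnj (- cis \<theta>) ^ p) \<partial>circ)
      \<longlonglongrightarrow> (\<integral>\<theta>. (1 - cis \<theta>) powr \<alpha> * ((- cis \<theta>) ^ q * cnj (- cis \<theta>) ^ p) \<partial>circ)"
  proof (rule integral_dominated_convergence[where w = w])
    show "(\<lambda>\<theta>. (1 - of_real (r i) * cis \<theta>) powr \<alpha> * ((- cis \<theta>) ^ q * cnj (- cis \<theta>) ^ p)) \<in> borel_measurable circ" for i
      using r[of i] by (intro circ_measurable_one_minus_cis_powr) auto
    show "(\<lambda>\<theta>. (1 - cis \<theta>) powr \<alpha> * ((- cis \<theta>) ^ q * cnj (- cis \<theta>) ^ p)) \<in> borel_measurable circ"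
      using circ_measurable_one_minus_cis_powr[of 1] by simp
    show "integrable circ w" by (rule w)
    show "AE \<theta> in circ. norm ((1 - of_real (r i) * cis \<theta>) powr \<alpha> * ((- cis \<theta>) ^ q * cnj (- cis \<theta>) ^ p)) \<le> w \<theta>" for i
    proof (rule AE_I2)
      fix \<theta> assume "\<theta> \<in> space circ"
      then show "norm ((1 - of_real (r i) * cis \<theta>) powr \<alpha> * ((- cis \<theta>) ^ q * cnj (- cis \<theta>) ^ p)) \<le> w \<theta>"
        using w(2)[of "r i" \<theta>] r[of i] by (simp add: norm_mult norm_power space_circ)
    qed
    show "AE \<theta> in circ. (\<lambda>i. (1 - of_real (r i) * cis \<theta>) powr \<alpha> * ((- cis \<theta>) ^ q * cnj (- cis \<theta>) ^ p))
        \<longlonglongrightarrow> (1 - cis \<theta>) powr \<alpha> * ((- cis \<theta>) ^ q * cnj (- cis \<theta>) ^ p)"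
    proof (rule AE_I2)
      fix \<theta> assume "\<theta> \<in> space circ"
      then have "1 - cis \<theta> \<notin> \<real>\<^sub>\<le>\<^sub>0"
        using Re_one_minus_cis_pos[of 1 \<theta>] by (auto simp: complex_nonpos_Reals_iff space_circ)
      moreover have "(\<lambda>i. 1 - of_real (r i) * cis \<theta>) \<longlonglongrightarrow> 1 - of_real 1 * cis \<theta>"
        by (intro tendsto_intros r_lim)
      ultimately show "(\<lambda>i. (1 - of_real (r i) * cis \<theta>) powr \<alpha> * ((- cis \<theta>) ^ q * cnj (- cis \<theta>) ^ p))
          \<longlonglongrightarrow> (1 - cis \<theta>) powr \<alpha> * ((- cis \<theta>) ^ q * cnj (- cis \<theta>) ^ p)"
        by (intro tendsto_mult_right tendsto_powr_complex) auto
    qed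
  qed
  moreover have "(\<lambda>i. \<integral>\<theta>. (1 - of_real (r i) * cis \<theta>) powr \<alpha> * ((- cis \<theta>) ^ q * cnj (- cis \<theta>) ^ p) \<partial>circ)
      \<longlonglongrightarrow> (if q \<le> p then 2 * of_real pi * (\<alpha> gchoose (p - q)) * of_real 1 ^ (p - q) else 0)"
  proof (rule Lim_transform_eventually)
    show "(\<lambda>i. if q \<le> p then 2 * of_real pi * (\<alpha> gchoose (p - q)) * of_real (r i) ^ (p - q) else 0)
        \<longlonglongrightarrow> (if q \<le> p then 2 * of_real pi * (\<alpha> gchoose (p - q)) * of_real 1 ^ (p - q) else 0)"
      by (cases "q \<le> p") (auto intro!: tendsto_intros tendsto_of_real r_lim simp del: of_real_1)
    show "eventually (\<lambda>i. (if q \<le> p then 2 * of_real pi * (\<alpha> gchoose (p - q)) * of_real (r i) ^ (p - q) else 0) =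
        (\<integral>\<theta>. (1 - of_real (r i) * cis \<theta>) powr \<alpha> * ((- cis \<theta>) ^ q * cnj (- cis \<theta>) ^ p) \<partial>circ)) sequentially"
      using r by (intro always_eventually allI circ_integral_binomial_inner[symmetric]) auto
  qed
  ultimately have "(\<integral>\<theta>. (1 - cis \<theta>) powr \<alpha> * ((- cis \<theta>) ^ q * cnj (- cis \<theta>) ^ p) \<partial>circ) =
      (if q \<le> p then 2 * of_real pi * (\<alpha> gchoose (p - q)) * of_real 1 ^ (p - q) else 0)"
    by (rule LIMSEQ_unique)
  then show ?thesis by (simp only: of_real_1 power_one mult_1_right)
qed

subsection \<open>Kummer's second transformation\<close>

text \<open>With \<open>d 0 = rGamma (\<mu> + 1)\<close>, this is the recurrence for the
  coefficients of 1F1(\<mu> + 1/2; 2 \<mu> + 1; 4 x) / \<Gamma>(\<mu> + 1). Passing from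
  \<open>j\<close> to \<open>j + 1\<close> raises the upper index of the binomial by two: one
  absorption identity for each unit, and the functional equation of \<open>rGamma\<close> for the
  other factor.\<close>

lemma rGamma_gchoose_rec:
  fixes \<mu> :: complex
  defines "d \<equiv> \<lambda>j. rGamma (\<mu> + of_nat j + 1) * ((2 * \<mu> + 2 * of_nat j) gchoose j)"
  shows "of_nat (Suc j) * (2 * \<mu> + 1 + of_nat j) * d (Suc j) = (4 * \<mu> + 2 + 4 * of_nat j) * d j"
proof -
  define \<beta> where "\<beta> = 2 * \<mu> + 2 * of_nat j"
  have 1: "of_nat (Suc j) * ((\<beta> + 2) gchoose Suc j) = (\<beta> + 2) * ((\<beta> + 1) gchoose j)"
    using gbinomial_absorption[of j "\<beta> + 2"] by (simp add: add_diff_eq add.commute)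
  have 2: "(2 * \<mu> + 1 + of_nat j) * ((\<beta> + 1) gchoose j) = (\<beta> + 1) * (\<beta> gchoose j)"
    using gbinomial_absorb_comp[of "\<beta> + 1" j] by (simp add: \<beta>_def algebra_simps)
  have 3: "(\<mu> + of_nat j + 1) * rGamma (\<mu> + of_nat j + 2) = rGamma (\<mu> + of_nat j + 1)"
    using rGamma_plus1[of "\<mu> + of_nat j + 1"] by (simp add: add_ac)
  have "of_nat (Suc j) * (2 * \<mu> + 1 + of_nat j) * d (Suc j) =
      rGamma (\<mu> + of_nat j + 2) * (2 * \<mu> + 1 + of_nat j) * (of_nat (Suc j) * ((\<beta> + 2) gchoose Suc j))"
    by (simp add: d_def \<beta>_def algebra_simps)
  also have "\<dots> = rGamma (\<mu> + of_nat j + 2) * (\<beta> + 2) * ((2 * \<mu> + 1 + of_nat j) * ((\<beta> + 1) gchoose j))"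
    unfolding 1 by simp
  also have "\<dots> = 2 * ((\<mu> + of_nat j + 1) * rGamma (\<mu> + of_nat j + 2)) * (\<beta> + 1) * (\<beta> gchoose j)"
    unfolding 2 by (simp add: \<beta>_def algebra_simps)
  also have "\<dots> = (4 * \<mu> + 2 + 4 * of_nat j) * d j"
    unfolding 3 by (simp add: \<beta>_def d_def algebra_simps)
  finally show ?thesis .
qed

text \<open>The recurrence says that \<open>F\<close> solves Kummer's equation; after multiplication by \<open>e\<^bsup>-2x\<^esup>\<close> the
  equation relates only coefficients whose indices differ by two.\<close>

lemma fps_kummer_ode:
  fixes F :: "complex fps"
  assumes "\<And>j. of_nat (Suc j) * (2 * \<mu> + 1 + of_nat j) * fps_nth F (Suc j) =
                 (4 * \<mu> + 2 + 4 * of_nat j) * fps_nth F j"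
  defines "G \<equiv> fps_exp (-2) * F"
  shows "fps_X * fps_deriv (fps_deriv G) + fps_const (2 * \<mu> + 1) * fps_deriv G = 4 * fps_X * G"
proof -
  define c where "c = fps_const (2 * \<mu> + 1)"
  \<comment> \<open>The recurrence read as an identity of generating functions.\<close>
  have F: "fps_X * fps_deriv (fps_deriv F) + c * fps_deriv F = 4 * fps_X * fps_deriv F + 2 * c * F"
  proof (rule fps_ext)
    fix n
    have "fps_nth (fps_X * fps_deriv (fps_deriv F) + c * fps_deriv F) n =
        of_nat (Suc n) * (2 * \<mu> + 1 + of_nat n) * fps_nth F (Suc n)"
      by (cases n) (simp_all add: c_def algebra_simps)
    also have "\<dots> = fps_nth (fps_const 4 * (fps_X * fps_deriv F) + fps_const 2 * (c * F)) n"
      unfolding assms(1) by (cases n) (simp_all add: c_def algebra_simps)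
    finally show "fps_nth (fps_X * fps_deriv (fps_deriv F) + c * fps_deriv F) n =
        fps_nth (4 * fps_X * fps_deriv F + 2 * c * F) n"
      by (simp add: mult.assoc numeral_fps_const)
  qed
  define E where "E = fps_exp (-2 :: complex)"
  have E: "fps_deriv E = - (E + E)"
    by (simp add: E_def numeral_fps_const flip: fps_const_neg mult_2)
  have G1: "fps_deriv G = E * (fps_deriv F - F - F)"
    by (simp add: G_def E_def[symmetric] E algebra_simps)
  have G2: "fps_deriv (fps_deriv G) = E * (fps_deriv (fps_deriv F) - 4 * fps_deriv F + 4 * F)"
    unfolding G1 by (simp add: E algebra_simps)
  \<comment> \<open>The term \<open>4 * fps_X * F\<close> coming from the second derivative of
    \<open>G\<close> cancels against \<open>4 * fps_X * G\<close>; what remains is \<open>E\<close>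
    times the equation for \<open>F\<close>.\<close>
  have "fps_X * fps_deriv (fps_deriv G) + c * fps_deriv G - 4 * fps_X * G =
      E * ((fps_X * fps_deriv (fps_deriv F) + c * fps_deriv F) - (4 * fps_X * fps_deriv F + 2 * c * F))"
    unfolding G2 unfolding G1 by (simp add: G_def E_def algebra_simps)
  then show ?thesis unfolding F by (simp add: c_def)
qed

text \<open>Comparing coefficients in the differential equation gives a two-step recurrence whose
  leading factor is nonzero because \<open>Re \<mu> > - 1 / 2\<close>. The odd coefficients vanish
  along with the first one, and the even ones follow from the constant term
  \<open>rGamma (\<mu> + 1)\<close>. Up to powers of -1, the even ones are the coefficients of the
  Bessel series.\<close>

lemma kummer_coefficients:
  fixes F :: "complex fps"
  assumes \<mu>: "Re \<mu> > - 1 / 2"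
  defines "F \<equiv> Abs_fps (\<lambda>j. rGamma (\<mu> + of_nat j + 1) * ((2 * \<mu> + 2 * of_nat j) gchoose j))"
  defines "G \<equiv> fps_exp (-2) * F"
  shows "fps_nth G (2 * l) = rGamma (\<mu> + of_nat l + 1) / fact l" (is ?even)
    and "fps_nth G (2 * l + 1) = 0" (is ?odd)
proof -
  have ode: "fps_X * fps_deriv (fps_deriv G) + fps_const (2 * \<mu> + 1) * fps_deriv G = 4 * (fps_X * G)"
    using fps_kummer_ode[of \<mu> F] rGamma_gchoose_rec[of _ \<mu>] by (simp add: G_def F_def mult.assoc)
  have nz: "2 * \<mu> + 1 + of_nat n \<noteq> 0" for n
    using \<mu> by (auto simp: complex_eq_iff)
  have "(2 * \<mu> + 1) * fps_nth G 1 = 0"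
    using arg_cong[OF ode, of "\<lambda>f. fps_nth f 0"] by (simp add: numeral_fps_const)
  then have G1: "fps_nth G 1 = 0" using nz[of 0] by simp
  have rec: "of_nat (n + 2) * (2 * \<mu> + 2 + of_nat n) * fps_nth G (n + 2) = 4 * fps_nth G n" for n
    using arg_cong[OF ode, of "\<lambda>f. fps_nth f (n + 1)"] by (simp add: numeral_fps_const algebra_simps)
  have nz2: "of_nat (n + 2) * (2 * \<mu> + 2 + of_nat n) \<noteq> 0" for n
  proof -
    have "2 * \<mu> + 2 + of_nat n \<noteq> 0" using nz[of "Suc n"] by (simp add: add_ac)
    moreover have "of_nat (n + 2) \<noteq> (0 :: complex)" by (simp only: of_nat_eq_0_iff)
    ultimately show ?thesis by (simp only: mult_eq_0_iff) simp
  qed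
  show ?odd
  proof (induction l)
    case 0
    then show ?case using G1 by simp
  next
    case (Suc l)
    then show ?case using rec[of "2 * l + 1"] nz2[of "2 * l + 1"] by auto
  qed
  show ?even
  proof (induction l)
    case 0
    then show ?case by (simp add: G_def F_def)
  next
    case (Suc l)
    have "rGamma (\<mu> + of_nat l + 1) = (\<mu> + of_nat l + 1) * rGamma (\<mu> + of_nat (Suc l) + 1)"
      using rGamma_plus1[of "\<mu> + of_nat l + 1"] by (simp add: add_ac)
    then have "of_nat (2 * l + 2) * (2 * \<mu> + 2 + of_nat (2 * l)) * (rGamma (\<mu> + of_nat (Suc l) + 1) / fact (Suc l)) =
        4 * (rGamma (\<mu> + of_nat l + 1) / fact l)"
      by (simp add: field_simps del: of_nat_Suc) (simp add: algebra_simps)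
    then have "of_nat (2 * l + 2) * (2 * \<mu> + 2 + of_nat (2 * l)) * (rGamma (\<mu> + of_nat (Suc l) + 1) / fact (Suc l)) =
        of_nat (2 * l + 2) * (2 * \<mu> + 2 + of_nat (2 * l)) * fps_nth G (2 * l + 2)"
      unfolding rec Suc .
    then have "rGamma (\<mu> + of_nat (Suc l) + 1) / fact (Suc l) = fps_nth G (2 * l + 2)"
      unfolding mult_left_cancel[OF nz2] .
    then show ?case by simp
  qed
qed

lemma summable_norm_kummer_series:
  fixes \<mu> x :: complex
  assumes \<mu>: "Re \<mu> > - 1 / 2"
  shows "summable (\<lambda>j. norm (rGamma (\<mu> + of_nat j + 1) * ((2 * \<mu> + 2 * of_nat j) gchoose j) * x ^ j))"
proof -
  define d where "d j = rGamma (\<mu> + of_nat j + 1) * ((2 * \<mu> + 2 * of_nat j) gchoose j)" for j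
  have nz: "2 * \<mu> + 1 + of_nat n \<noteq> 0" for n
    using \<mu> by (auto simp: complex_eq_iff)
  have ratio: "d (Suc j) = (4 * \<mu> + 2 + 4 * of_nat j) / (of_nat (Suc j) * (2 * \<mu> + 1 + of_nat j)) * d j" for j
    using rGamma_gchoose_rec[of j \<mu>, folded d_def] nz[of j]
    by (simp add: eq_divide_eq mult_ac del: of_nat_Suc)
  have lim: "(\<lambda>j. (4 * \<mu> + 2 + 4 * of_nat j) / (of_nat (Suc j) * (2 * \<mu> + 1 + of_nat j))) \<longlonglongrightarrow> 0"
  proof -
    \<comment> \<open>The numerator is \<open>2 * A + 2 * B - 2\<close> in terms of the factors
      \<open>A\<close>, \<open>B\<close> of the denominator, which splits the ratio into products of
      null sequences.\<close>
    have "(\<lambda>j. 2 * inverse (1 + of_nat j) + 2 * inverse (2 * \<mu> + 1 + of_nat j) -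
        2 * inverse (1 + of_nat j) * inverse (2 * \<mu> + 1 + of_nat j)) \<longlonglongrightarrow> 2 * 0 + 2 * 0 - 2 * 0 * 0"
      by (intro tendsto_intros inverse_plus_of_nat_tendsto_0)
    moreover have "2 * inverse (1 + of_nat j) + 2 * inverse (2 * \<mu> + 1 + of_nat j) -
        2 * inverse (1 + of_nat j) * inverse (2 * \<mu> + 1 + of_nat j) =
        (4 * \<mu> + 2 + 4 * of_nat j) / (of_nat (Suc j) * (2 * \<mu> + 1 + of_nat j))" for j
    proof -
      define A B where "A = 1 + (of_nat j :: complex)" and "B = 2 * \<mu> + 1 + of_nat j"
      have "A \<noteq> 0" unfolding A_def by (metis of_nat_Suc of_nat_eq_0_iff nat.simps(3))
      moreover have "B \<noteq> 0" using nz by (simp add: B_def)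
      ultimately have "2 * inverse A + 2 * inverse B - 2 * inverse A * inverse B = (2 * B + 2 * A - 2) / (A * B)"
        by (simp add: field_simps)
      also have "2 * B + 2 * A - 2 = 4 * \<mu> + 2 + 4 * of_nat j" by (simp add: A_def B_def)
      finally show ?thesis by (simp add: A_def B_def)
    qed
    ultimately show ?thesis by simp
  qed
  have "summable (\<lambda>j. norm (d j * x ^ j))"
    using ratio lim by (rule summable_norm_power_series_ratio_null)
  then show ?thesis by (simp only: d_def)
qed

text \<open>Evaluate \<open>G = fps_exp (-2) * F\<close> at \<open>x = - \<i> * z / 2\<close>: the
  exponential becomes \<open>exp (\<i> * z)\<close>, and since only even powers survive and the
  square of \<open>x\<close> is minus that of \<open>z / 2\<close>, the left side is the Bessel
  series.\<close>

lemma bessel_J_kummer: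
  assumes \<mu>: "Re \<mu> > - 1 / 2"
  shows "bessel_J \<mu> z = cpow (z / 2) \<mu> * (exp (\<i> * z) *
    (\<Sum>j. rGamma (\<mu> + of_nat j + 1) * ((2 * \<mu> + 2 * of_nat j) gchoose j) * (- \<i> * z / 2) ^ j))"
proof -
  define d where "d j = rGamma (\<mu> + of_nat j + 1) * ((2 * \<mu> + 2 * of_nat j) gchoose j)" for j
  define F where "F = Abs_fps d"
  define G where "G = fps_exp (-2) * F"
  define x where "x = - \<i> * z / 2"
  have "summable (\<lambda>n. norm (d n * of_real r ^ n))" for r :: real
    unfolding d_def by (rule summable_norm_kummer_series[OF \<mu>])
  then have "fps_conv_radius F = \<infinity>"
    unfolding F_def fps_conv_radius_def fps_nth_Abs_fps
    by (intro conv_radius_inftyI'[of 0]) (metis abs_of_pos norm_of_real summable_norm_cancel)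
  then have radius: "norm x < fps_conv_radius F" "norm x < fps_conv_radius (fps_exp (-2 :: complex))"
    by simp_all
  have eval: "eval_fps G x = exp (\<i> * z) * eval_fps F x"
    unfolding G_def eval_fps_mult[OF radius(2) radius(1)] by (simp add: x_def)
  have "norm x < fps_conv_radius G"
    unfolding G_def using radius fps_conv_radius_mult[of "fps_exp (-2)" F]
    by (metis less_le_trans min_less_iff_conj)
  then have "(\<lambda>n. fps_nth G n * x ^ n) sums eval_fps G x"
    by (rule sums_eval_fps)
  then have "(\<lambda>l. fps_nth G (2 * l) * x ^ (2 * l)) sums eval_fps G x"
  proof (subst sums_mono_reindex)
    show "fps_nth G n * x ^ n = 0" if "n \<notin> range (\<lambda>l. 2 * l)" for n
    proof -
      have "odd n" using that by (auto elim!: evenE)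
      then obtain l where "n = 2 * l + 1" by (elim oddE)
      then show ?thesis using kummer_coefficients(2)[OF \<mu>] by (simp add: G_def F_def d_def[abs_def])
    qed
  qed (auto simp: strict_mono_def)
  moreover have "fps_nth G (2 * l) * x ^ (2 * l) =
      (-1) ^ l * (z / 2) ^ (2 * l) / (fact l * Gamma (\<mu> + of_nat l + 1))" for l
  proof -
    have "x ^ (2 * l) = (-1) ^ l * (z / 2) ^ (2 * l)"
    proof -
      have "x\<^sup>2 = - 1 * (z / 2)\<^sup>2" by (simp add: x_def power_mult_distrib power_divide)
      then show ?thesis by (simp only: power_mult power_mult_distrib)
    qed
    moreover have "fps_nth G (2 * l) = rGamma (\<mu> + of_nat l + 1) / fact l"
      using kummer_coefficients(1)[OF \<mu>] by (simp add: G_def F_def d_def[abs_def])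
    ultimately show ?thesis
      by (simp only: rGamma_inverse_Gamma divide_inverse inverse_mult_distrib mult_ac)
  qed
  ultimately have "(\<Sum>l. (-1) ^ l * (z / 2) ^ (2 * l) / (fact l * Gamma (\<mu> + of_nat l + 1))) = eval_fps G x"
    by (simp add: sums_iff)
  then show ?thesis
    unfolding bessel_J_def eval by (simp add: eval_fps_def F_def d_def x_def)
qed

subsection \<open>The kernel\<close>

text \<open>Put \<phi> = \<theta> - \<pi> sgn \<theta>. Then \<open>1 - cis \<theta>\<close> is
  \<open>2 * cos (\<phi> / 2) * cis (\<phi> / 2)\<close> and \<open>1 - cos \<theta>\<close> is
  twice the square of \<open>cos (\<phi> / 2)\<close>. The sign shift in the kernel is thus exactly
  what makes the product a principal power.\<close>

lemma cpow_one_minus_cos: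
  assumes "\<theta> \<in> {-pi..pi} - {0}"
  shows "cpow (of_real (1 - cos \<theta>)) a * exp (\<i> * a * of_real (\<theta> - pi * sgn \<theta>)) =
    2 powr (- a) * (1 - cis \<theta>) powr (2 * a)"
proof -
  define \<phi> where "\<phi> = \<theta> - pi * sgn \<theta>"
  define c where "c = cos (\<phi> / 2)"
  have \<phi>: "\<bar>\<phi>\<bar> < pi" using assms by (auto simp: \<phi>_def sgn_if)
  then have c: "c > 0" unfolding c_def by (intro cos_gt_zero_pi) auto
  have cis: "cis \<theta> = - cis \<phi>" using assms by (auto simp: \<phi>_def sgn_if complex_eq_iff)
  have "cos \<theta> = - cos \<phi>" using assms by (auto simp: \<phi>_def sgn_if)
  then have cos: "1 - cos \<theta> = 2 * c * c"
    using cos_double_cos[of "\<phi> / 2"] by (simp add: c_def power2_eq_square)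
  have "sin \<phi> = 2 * sin (\<phi> / 2) * c" using sin_double[of "\<phi> / 2"] by (simp add: c_def)
  then have eq: "1 - cis \<theta> = of_real (2 * c) * cis (\<phi> / 2)"
    using cos \<open>cos \<theta> = - cos \<phi>\<close> by (simp add: cis complex_eq_iff c_def[symmetric])
  then have nz: "1 - cis \<theta> \<noteq> 0" using c by (simp del: of_real_mult)
  \<comment> \<open>The logarithm is the principal one because \<phi>/2 lies strictly between
    -\<pi>/2 and \<pi>/2.\<close>
  have Ln: "Ln (1 - cis \<theta>) = of_real (ln 2 + ln c) + \<i> * of_real (\<phi> / 2)"
  proof (rule Ln_unique)
    show "exp (of_real (ln 2 + ln c) + \<i> * of_real (\<phi> / 2)) = 1 - cis \<theta>"
    proof -
      have "exp (of_real (ln 2 + ln c)) = (of_real (2 * c) :: complex)"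
        using c by (simp add: exp_of_real exp_add del: of_real_add)
      then show ?thesis unfolding eq by (simp add: exp_add cis_conv_exp)
    qed
  qed (use \<phi> in auto)
  show ?thesis
  proof (cases "a = 0")
    case True
    then show ?thesis using nz by (simp add: cpow_def)
  next
    case False
    have "Ln (of_real (1 - cos \<theta>)) = of_real (ln 2 + ln c + ln c)"
      using c by (simp add: cos Ln_of_real ln_mult flip: of_real_mult)
    moreover have "1 - cos \<theta> \<noteq> 0" using cos c by simp
    moreover have "Ln 2 = of_real (ln 2)" using Ln_of_real[of 2] by simp
    ultimately have "cpow (of_real (1 - cos \<theta>)) a * exp (\<i> * a * of_real \<phi>) =
        exp (a * of_real (ln 2 + ln c + ln c) + \<i> * a * of_real \<phi>)"
      using False by (simp add: cpow_def powr_def exp_add del: of_real_add of_real_diff)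
    also have "a * of_real (ln 2 + ln c + ln c) + \<i> * a * of_real \<phi> =
        - a * of_real (ln 2) + 2 * a * (of_real (ln 2 + ln c) + \<i> * of_real (\<phi> / 2))"
      by (simp add: algebra_simps)
    also have "exp \<dots> = 2 powr (- a) * (1 - cis \<theta>) powr (2 * a)"
      using nz by (simp only: exp_add Ln[symmetric] \<open>Ln 2 = of_real (ln 2)\<close>[symmetric])
        (simp add: powr_def)
    finally show ?thesis unfolding \<phi>_def .
  qed
qed

text \<open>Division by the positive number 2 leaves the argument unchanged, so principal logarithms
  subtract. For \<open>a = 0\<close> both sides are \<open>(z / 2) ^ N\<close>, including
  \<open>z = 0\<close>.\<close>

lemma cpow_half:
  assumes "a = 0 \<or> z \<notin> \<real>\<^sub>\<le>\<^sub>0"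
  shows "cpow z a * 2 powr (- a) * (z / 2) ^ N = cpow (z / 2) (a + of_nat N)"
proof (cases "a = 0")
  case True
  then show ?thesis using cpow_of_nat[of "z / 2" N] by (simp add: cpow_def)
next
  case False
  then have z: "z \<noteq> 0" using assms by auto
  have Ln: "Ln (z / 2) = Ln z - Ln 2"
    using Ln_divide_of_real[of 2 z] z Ln_of_real[of 2] by simp
  have "(z / 2) powr a = z powr a * 2 powr (- a)"
    using z unfolding powr_def Ln by (simp add: right_diff_distrib exp_add[symmetric])
  moreover have "(z / 2) powr (a + of_nat N) = (z / 2) powr a * (z / 2) ^ N"
    using z powr_nat'[of "z / 2" N] by (simp add: powr_add)
  moreover have "cpow (z / 2) (a + of_nat N) = (z / 2) powr (a + of_nat N)"
    using z by (simp add: cpow_def)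
  ultimately show ?thesis using False by (simp add: cpow_def)
qed

text \<open>Truncation is towards zero, so the values between -1 and 0 have integer part 0. Hence
  the integer part of \<open>Re \<nu>\<close> can be treated as a natural number.\<close>

lemma int_part_nonneg: "x > -1 \<Longrightarrow> int_part x \<ge> 0"
  by (auto simp: int_part_def ceiling_def floor_less_iff not_le le_floor_iff)

text \<open>A nonnegative real part is reduced to one in [0, 1), and a negative one above -1/2 is
  left as it is. This gives the exponent \<open>2 * cfrac_part \<nu>\<close> real part above -1, as
  integrability requires.\<close>

lemma Re_cfrac_part:
  assumes "Re \<nu> > - 1 / 2"
  shows "Re (cfrac_part \<nu>) > - 1 / 2"
proof (cases "Re \<nu> \<ge> 0")
  case True
  then show ?thesis by (simp add: cfrac_part_def int_part_def) linarith
next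
  case False
  then have "\<lceil>Re \<nu>\<rceil> = 0" using assms by (simp add: ceiling_eq_iff)
  then show ?thesis using False assms by (simp add: cfrac_part_def int_part_def)
qed

lemma cfrac_part_of_nat: "\<nu> \<in> \<nat> \<Longrightarrow> cfrac_part \<nu> = 0"
  by (auto simp: Nats_def cfrac_part_def int_part_def)

lemma neumann_kernel_series:
  fixes n :: nat
  assumes \<nu>: "Re \<nu> > - 1 / 2" and \<theta>: "\<theta> \<in> {-pi..pi} - {0}"
  defines "a \<equiv> cfrac_part \<nu>" and "N \<equiv> nat (int_part (Re \<nu>)) + n"
  shows "neumann_kernel \<nu> z \<theta> * exp (\<i> * of_real (\<theta> - pi / 2)) ^ n =
    (\<Sum>k. \<i> ^ N * cpow z a * exp (\<i> * z) * 2 powr (- a) * (- \<i> * z / 2) ^ k * rGamma (a + of_nat k + 1) *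
      ((1 - cis \<theta>) powr (2 * a + 2 * of_nat k) * ((- cis \<theta>) ^ N * cnj (- cis \<theta>) ^ k)))"
proof -
  define m where "m = nat (int_part (Re \<nu>))"
  define \<phi> where "\<phi> = \<theta> - pi * sgn \<theta>"
  define u where "u = - cis \<theta>"
  define v where "v = 1 - cis \<theta>"
  define C where "C = \<i> ^ N * cpow z a * exp (\<i> * z) * 2 powr (- a)"
  have "int_part (Re \<nu>) \<ge> 0" using \<nu> by (intro int_part_nonneg) auto
  then have m: "int_part (Re \<nu>) = int m" by (simp add: m_def)
  then have \<nu>_eq: "\<nu> = a + of_nat m" by (simp add: a_def cfrac_part_def)
  have N: "N = m + n" by (simp add: N_def m_def)
  have "Re v > 0" using Re_one_minus_cis_pos[of 1 \<theta>] \<theta> by (simp add: v_def)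
  then have v0: "v \<noteq> 0" by auto
  have cis: "exp (\<i> * of_real t) = cis t" for t by (simp add: cis_conv_exp)
  have u\<phi>: "exp (\<i> * of_real \<phi>) = u"
    unfolding cis using \<theta> by (auto simp: \<phi>_def u_def sgn_if complex_eq_iff)
  have un: "exp (\<i> * of_real (\<theta> - pi / 2)) = \<i> * u"
    unfolding cis by (auto simp: u_def complex_eq_iff cos_diff sin_diff)
  have exp\<nu>: "exp (\<i> * \<nu> * of_real \<phi>) = exp (\<i> * a * of_real \<phi>) * u ^ m"
    unfolding \<nu>_eq u\<phi>[symmetric] by (simp only: exp_of_nat_mult[symmetric] exp_add[symmetric]) (simp add: algebra_simps)
  \<comment> \<open>Here \<open>v = 1 + u\<close> and \<open>cnj u\<close> is the inverse of
    \<open>u\<close>, so the right side is \<open>(cnj u + 2 + u) / 2\<close>.\<close>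
  have cos: "of_real (1 - cos \<theta>) = v\<^sup>2 * cnj u / 2"
    using sin_cos_squared_add[of \<theta>]
    by (simp add: v_def u_def complex_eq_iff power2_eq_square) algebra
  have "neumann_kernel \<nu> z \<theta> = (exp (\<i> * of_real pi * \<nu> / 2) *
      reg_gamma_P a (cmod z * (1 - cos \<theta>)) (Arg z - pi / 2)) * exp (\<i> * \<nu> * of_real \<phi>) * exp (\<i> * z * of_real (cos \<theta>))"
    by (simp add: neumann_kernel_def a_def \<phi>_def)
  also have "\<dots> = \<i> ^ m * cpow z a * cpow (of_real (1 - cos \<theta>)) a *
      gamma_star a (- \<i> * z * of_real (1 - cos \<theta>)) * (exp (\<i> * a * of_real \<phi>) * u ^ m) * exp (\<i> * z * of_real (cos \<theta>))"
    unfolding a_def reg_gamma_P_principal_branch by (simp add: m exp\<nu>[unfolded a_def])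
  also have "\<dots> = \<i> ^ m * cpow z a * (cpow (of_real (1 - cos \<theta>)) a * exp (\<i> * a * of_real \<phi>)) *
      (exp (\<i> * z * of_real (1 - cos \<theta>)) * exp (\<i> * z * of_real (cos \<theta>))) * u ^ m *
      (\<Sum>k. (- \<i> * z * of_real (1 - cos \<theta>)) ^ k * rGamma (a + of_nat k + 1))"
    by (simp add: gamma_star_def)
  \<comment> \<open>The exponential factor of \<open>gamma_star\<close> and that of the kernel
    combine to a constant in \<theta>.\<close>
  also have "exp (\<i> * z * of_real (1 - cos \<theta>)) * exp (\<i> * z * of_real (cos \<theta>)) = exp (\<i> * z)"
    by (simp add: exp_add[symmetric] algebra_simps)
  also have "cpow (of_real (1 - cos \<theta>)) a * exp (\<i> * a * of_real \<phi>) = 2 powr (- a) * v powr (2 * a)"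
    unfolding \<phi>_def v_def by (rule cpow_one_minus_cos[OF \<theta>])
  finally have K: "neumann_kernel \<nu> z \<theta> * (\<i> * u) ^ n = C * v powr (2 * a) * u ^ N *
      (\<Sum>k. (- \<i> * z * of_real (1 - cos \<theta>)) ^ k * rGamma (a + of_nat k + 1))"
    by (simp add: C_def N power_add power_mult_distrib)
  have "summable (\<lambda>k. (- \<i> * z * of_real (1 - cos \<theta>)) ^ k * rGamma (a + of_nat k + 1))"
    using summable_norm_cancel[OF summable_norm_rGamma_series[of a "- \<i> * z * of_real (1 - cos \<theta>)"]]
    by (simp only: mult.commute)
  note K2 = suminf_mult[OF this, of "C * v powr (2 * a) * u ^ N"]
  have summand: "C * v powr (2 * a) * u ^ N * ((- \<i> * z * of_real (1 - cos \<theta>)) ^ k * rGamma (a + of_nat k + 1)) =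
      C * (- \<i> * z / 2) ^ k * rGamma (a + of_nat k + 1) * (v powr (2 * a + 2 * of_nat k) * (u ^ N * cnj u ^ k))" for k
  proof -
    have "v powr (2 * a + 2 * of_nat k) = v powr (2 * a) * (v\<^sup>2) ^ k"
      using v0 powr_nat'[of v "2 * k"] by (simp add: powr_add power_mult)
    moreover have "(- \<i> * z * of_real (1 - cos \<theta>)) ^ k = (- \<i> * z / 2) ^ k * (v\<^sup>2) ^ k * cnj u ^ k"
      unfolding cos by (simp only: flip: power_mult_distrib) (simp add: mult.assoc)
    ultimately show ?thesis by (simp only: mult_ac)
  qed
  show ?thesis
    using K K2 unfolding summand un by (simp only: u_def v_def C_def)
qed

text \<open>Integrating the expansion term by term turns each power into a binomial coefficient,
  nonzero only for \<open>k \<ge> N\<close>. With \<open>k = j + N\<close> and \<mu> = \<nu> + n = a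
  + N, the coefficients become those of the Kummer form of \<open>bessel_J \<mu> z\<close>.\<close>

lemma neumann_kernel_fourier:
  assumes \<nu>: "Re \<nu> > - 1 / 2" and z: "\<nu> \<notin> \<nat> \<Longrightarrow> z \<notin> \<real>\<^sub>\<le>\<^sub>0"
  shows "integrable circ (\<lambda>\<theta>. neumann_kernel \<nu> z \<theta> * exp (\<i> * of_real (\<theta> - pi / 2)) ^ n)" (is ?int)
    and "(\<integral>\<theta>. neumann_kernel \<nu> z \<theta> * exp (\<i> * of_real (\<theta> - pi / 2)) ^ n \<partial>circ) =
      2 * of_real pi * bessel_J (\<nu> + of_nat n) z" (is ?eq)
proof -
  define a where "a = cfrac_part \<nu>"
  define N where "N = nat (int_part (Re \<nu>)) + n"
  define \<mu> where "\<mu> = \<nu> + of_nat n"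
  define x where "x = - \<i> * z / 2"
  define C where "C = \<i> ^ N * cpow z a * exp (\<i> * z) * 2 powr (- a)"
  define b where "b k \<theta> = (1 - cis \<theta>) powr (2 * a + 2 * of_nat k) * ((- cis \<theta>) ^ N * cnj (- cis \<theta>) ^ k)" for k \<theta>
  define f where "f k \<theta> = C * x ^ k * rGamma (a + of_nat k + 1) * b k \<theta>" for k \<theta>
  define d where "d j = rGamma (\<mu> + of_nat j + 1) * ((2 * \<mu> + 2 * of_nat j) gchoose j)" for j
  have "int_part (Re \<nu>) \<ge> 0" using \<nu> by (intro int_part_nonneg) auto
  then have \<mu>: "\<mu> = a + of_nat N" by (simp add: \<mu>_def a_def N_def cfrac_part_def)
  have a: "Re (2 * a) > -1" using Re_cfrac_part[OF \<nu>] by (simp add: a_def)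
  have az: "a = 0 \<or> z \<notin> \<real>\<^sub>\<le>\<^sub>0" using z cfrac_part_of_nat by (auto simp: a_def)
  \<comment> \<open>The majorant for \<open>k = 0\<close> serves all \<open>k\<close>: the extra
    factor \<open>norm v ^ (2 * k)\<close> is at most \<open>4 ^ k\<close>, which is absorbed into
    the everywhere convergent \<open>rGamma\<close> series at \<open>4 * x\<close>.\<close>
  obtain w where w: "integrable circ w"
    "\<And>r \<theta>. r \<in> {0..1} \<Longrightarrow> \<theta> \<in> {-pi..pi} - {0} \<Longrightarrow> norm ((1 - of_real r * cis \<theta>) powr (2 * a)) \<le> w \<theta>"
    using one_minus_cis_powr_dominated[OF a] by blast
  have kernel: "neumann_kernel \<nu> z \<theta> * exp (\<i> * of_real (\<theta> - pi / 2)) ^ n = (\<Sum>k. f k \<theta>)" if "\<theta> \<in> space circ" for \<theta>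
    using neumann_kernel_series[OF \<nu>] that
    by (simp only: space_circ f_def b_def C_def x_def a_def N_def)
  have meas: "f k \<in> borel_measurable circ" for k
    unfolding f_def b_def using circ_measurable_one_minus_cis_powr[of 1] by simp
  have bound: "norm (f k \<theta>) \<le> norm C * norm (rGamma (a + of_nat k + 1) * (4 * x) ^ k) * w \<theta>"
    if "\<theta> \<in> space circ" for k \<theta>
  proof -
    define v where "v = 1 - cis \<theta>"
    have t: "\<theta> \<in> {-pi..pi} - {0}" using that by (simp add: space_circ)
    have "Re v > 0" using Re_one_minus_cis_pos[of 1 \<theta>] t by (simp add: v_def)
    then have v0: "v \<noteq> 0" by auto
    have "norm v \<le> 2" unfolding v_def using norm_triangle_ineq4[of 1 "cis \<theta>"] by simp
    then have "norm v ^ (2 * k) \<le> 2 ^ (2 * k)" by (intro power_mono) auto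
    then have v4: "norm v ^ (2 * k) \<le> 4 ^ k" by (simp add: power_mult)
    have "norm (b k \<theta>) = norm (v powr (2 * a)) * norm v ^ (2 * k)"
      unfolding b_def v_def[symmetric] using v0 powr_nat'[of v "2 * k"]
      by (simp add: norm_mult norm_power powr_add)
    also have "\<dots> \<le> w \<theta> * 4 ^ k"
      using w(2)[of 1 \<theta>] t v4 by (intro mult_mono) (auto simp: v_def intro: order_trans[OF norm_ge_zero])
    finally have "norm (f k \<theta>) \<le> norm (C * x ^ k * rGamma (a + of_nat k + 1)) * (w \<theta> * 4 ^ k)"
      unfolding f_def norm_mult[of _ "b k \<theta>"] by (intro mult_left_mono) auto
    then show ?thesis by (simp add: norm_mult norm_power power_mult_distrib mult_ac)
  qed
  have B: "summable (\<lambda>k. norm C * norm (rGamma (a + of_nat k + 1) * (4 * x) ^ k))"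
    by (intro summable_mult summable_norm_rGamma_series)
  note series = dominated_series_integrable[OF meas w(1) bound B] dominated_series_sums[OF meas w(1) bound B]
  show ?int
    using series(1) by (subst Bochner_Integration.integrable_cong[OF refl kernel])
  have int_f: "integral\<^sup>L circ (f k) = C * x ^ k * rGamma (a + of_nat k + 1) *
      (if N \<le> k then 2 * of_real pi * ((2 * a + 2 * of_nat k) gchoose (k - N)) else 0)" for k
  proof -
    have "Re (2 * a + 2 * of_nat k) > -1" using a by simp
    then show ?thesis
      unfolding f_def b_def by (simp only: integral_mult_right_zero circ_integral_binomial)
  qed
  \<comment> \<open>The first \<open>N\<close> integrals vanish, so dropping them does not change
    the sum.\<close>
  have "(\<lambda>j. integral\<^sup>L circ (f (j + N))) sums (\<integral>\<theta>. (\<Sum>k. f k \<theta>) \<partial>circ)"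
    using series(2) by (subst sums_zero_iff_shift) (simp_all add: int_f)
  moreover have "integral\<^sup>L circ (f (j + N)) = (C * x ^ N * (2 * of_real pi)) * (d j * x ^ j)" for j
    by (simp add: int_f d_def \<mu> power_add algebra_simps)
  ultimately have sums: "(\<lambda>j. (C * x ^ N * (2 * of_real pi)) * (d j * x ^ j)) sums (\<integral>\<theta>. (\<Sum>k. f k \<theta>) \<partial>circ)"
    by simp
  have \<mu>_gt: "Re \<mu> > - 1 / 2" using \<nu> by (simp add: \<mu>_def)
  note J = bessel_J_kummer[OF \<mu>_gt, of z, folded d_def x_def]
  have "(\<integral>\<theta>. (\<Sum>k. f k \<theta>) \<partial>circ) = (C * x ^ N * (2 * of_real pi)) * (\<Sum>j. d j * x ^ j)"
  proof -
    have "summable (\<lambda>j. d j * x ^ j)"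
      unfolding d_def by (rule summable_norm_cancel, rule summable_norm_kummer_series[OF \<mu>_gt])
    then show ?thesis using sums by (simp only: sums_iff suminf_mult)
  qed
  \<comment> \<open>The factor \<open>\<i> ^ N\<close> in \<open>C\<close> cancels the rotation in
    \<open>x ^ N\<close>, leaving the prefactor \<open>cpow (z / 2) \<mu>\<close> of the Bessel
    function.\<close>
  also have "C * x ^ N = cpow z a * 2 powr (- a) * (\<i> * x) ^ N * exp (\<i> * z)"
    by (simp add: C_def power_mult_distrib)
  also have "\<i> * x = z / 2" by (simp add: x_def)
  also have "cpow z a * 2 powr (- a) * (z / 2) ^ N = cpow (z / 2) \<mu>"
    unfolding \<mu> by (rule cpow_half[OF az])
  finally have "(\<integral>\<theta>. (\<Sum>k. f k \<theta>) \<partial>circ) = 2 * of_real pi * bessel_J \<mu> z"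
    by (simp add: J)
  then show ?eq
    unfolding \<mu>_def[symmetric] by (subst Bochner_Integration.integral_cong[OF refl kernel])
qed

section \<open>Summation of the Neumann series under the integral\<close>

theorem theorem5p1:
  fixes a :: "nat \<Rightarrow> complex" and \<nu> z :: complex
  assumes "a \<longlonglongrightarrow> 0"
    and "summable (\<lambda>n. norm (a n))"
    and "Re \<nu> > - 1 / 2"
    and "\<nu> \<notin> \<nat> \<Longrightarrow> z \<notin> \<real>\<^sub>\<le>\<^sub>0"
  shows "summable (\<lambda>n. a n * bessel_J (\<nu> + of_nat n) z) \<and>
    set_integrable lborel {-pi..pi}
      (\<lambda>\<theta>. neumann_kernel \<nu> z \<theta> * gen_series a (exp (\<i> * of_real (\<theta> - pi / 2)))) \<and>
    neumann_series a \<nu> z = 1 / (2 * of_real pi) *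
      (LINT \<theta>:{-pi..pi}|lborel.
        neumann_kernel \<nu> z \<theta> * gen_series a (exp (\<i> * of_real (\<theta> - pi / 2))))"
proof -
  define K where "K = neumann_kernel \<nu> z"
  define e where "e \<theta> = exp (\<i> * of_real (\<theta> - pi / 2))" for \<theta> :: real
  have norm_e: "norm (e \<theta>) = 1" for \<theta>
    unfolding e_def by (rule norm_exp_i_times)
  define f where "f n \<theta> = a n * (K \<theta> * e \<theta> ^ n)" for n \<theta>
  note fourier = neumann_kernel_fourier[OF assms(3,4), folded K_def e_def]
  have sum_f: "(\<Sum>n. f n \<theta>) = K \<theta> * gen_series a (e \<theta>)" for \<theta>
  proof -
    have "summable (\<lambda>n. a n * e \<theta> ^ n)"
      by (rule summable_norm_cancel) (use assms(2) norm_e in \<open>simp add: norm_mult norm_power\<close>)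
    from suminf_mult[OF this, of "K \<theta>"] show ?thesis
      by (simp add: f_def gen_series_def mult_ac)
  qed
  \<comment> \<open>The case \<open>n = 0\<close> is integrability of the kernel itself, whose norm
    dominates every term because \<open>e \<theta>\<close> has norm 1.\<close>
  have int_K: "integrable circ (\<lambda>\<theta>. norm (K \<theta>))"
    using fourier(1)[of 0] by simp
  have meas: "f n \<in> borel_measurable circ" for n
    unfolding f_def using borel_measurable_integrable[OF fourier(1)[of n]] by simp
  have bound: "norm (f n \<theta>) \<le> norm (a n) * norm (K \<theta>)" for n \<theta>
    by (simp add: f_def norm_mult norm_power norm_e)
  have int: "integrable circ (\<lambda>\<theta>. K \<theta> * gen_series a (e \<theta>))"
    using dominated_series_integrable[OF meas int_K bound assms(2)] by (simp add: sum_f)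
  have "(\<lambda>n. integral\<^sup>L circ (f n)) sums (\<integral>\<theta>. K \<theta> * gen_series a (e \<theta>) \<partial>circ)"
    using dominated_series_sums[OF meas int_K bound assms(2)] by (simp add: sum_f)
  moreover have "integral\<^sup>L circ (f n) = (2 * of_real pi) * (a n * bessel_J (\<nu> + of_nat n) z)" for n
    unfolding f_def using fourier(2)[of n] by simp
  ultimately have "(\<lambda>n. (2 * of_real pi) * (a n * bessel_J (\<nu> + of_nat n) z)) sums
      (\<integral>\<theta>. K \<theta> * gen_series a (e \<theta>) \<partial>circ)"
    by simp
  from sums_mult[OF this, of "1 / (2 * of_real pi)"]
  have "(\<lambda>n. a n * bessel_J (\<nu> + of_nat n) z) sums
      (1 / (2 * of_real pi) * (\<integral>\<theta>. K \<theta> * gen_series a (e \<theta>) \<partial>circ))"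
    by simp
  then show ?thesis
    using int unfolding circ_integrable_iff circ_integral_eq K_def e_def neumann_series_def
    by (simp add: sums_iff)
qed

end
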